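(* Let $(X,e)$ be a quasi-metric space and let $T:X\to X$ be a continuous map. Let $m_e$ be the metric on $X$ given by $m_e(x,y)=\max\{e(x,y),e(y,x)\}$. Then $$h_{m_e}(T)=h'_e(T).$$
   Context: A quasi-metric on a set $X$ is a function $e:X\times X\to[0,+\infty)$ such that for all $x,y,z\in X$: $e(x,y)\ge 0$; $e(x,y)=0$ if and only if $x=y$; and $e(x,z)\le e(x,y)+e(y,z)$ (symmetry is not required). The space $X$ carries the topology generated by the sets $B_t(p)=\{x\in X: e(x,p)<t \text{ and } e(p,x)<t\}$, $p\in X$, $t>0$; this coincides with the topology of the metric $m_e$. Continuity and compactness refer to this topology. Entropy for the quasi-metric: for $n\ge 1$ put $e_n(x,y)=\max_{0\le i\le n-1}e(T^i(x),T^i(y))$. For $K\subseteq X$ compact and $\epsilon>0$, a subset $F\subseteq X$ is an $(n,\epsilon)$-spanning set of $K$ with respect to $T$ and $e$ if for every $x\in K$ there is $y\in F$ with $e_n(x,y)\le\epsilon$ and $e_n(y,x)\le\epsilon$. Let $r'_n(\epsilon,K,T,e)$ be the smallest cardinality of such a set, and define $$h'_e(T)=\sup_K\lim_{\epsilon\to 0}\limsup_{n\to\infty}\frac{\log r'_n(\epsilon,K,T,e)}{n},$$ the supremum being over all compact subsets $K$ of $X$. Entropy for a metric $d$ on $X$ (Bowen's definition): put $d_n(x,y)=\max_{0\le i\le n-1}d(T^i(x),T^i(y))$; a subset $F\subseteq X$ is an $(n,\epsilon)$-spanning set for $K$ with respect to $d$ and $T$ if for every $x\in K$ there is $y\in F$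 with $d_n(x,y)\le\epsilon$; $r_n(\epsilon,K,T,d)$ is the smallest cardinality of such a set; and $$h_d(T)=\sup_K\lim_{\epsilon\to 0}\limsup_{n\to\infty}\frac{\log r_n(\epsilon,K,T,d)}{n},$$ the supremum being over all compact subsets $K$ of $X$. Entropies take extended real values, with the convention $\log 0=-\infty$ (relevant only for $K=\emptyset$). *)

theory Defs
  imports "HOL-Analysis.Analysis"
begin

text \<open>As for the library locale \<^locale>\<open>Metric_space\<close>, the distance is a total function with
  non-negative values; only its values on \<open>X \<times> X\<close> matter.\<close>

locale Quasi_metric_space =
  fixes X :: "'a set" and e :: "'a \<Rightarrow> 'a \<Rightarrow> real"
  assumes nonneg: "\<And>x y. 0 \<le> e x y"
    and zero: "\<And>x y. \<lbrakk>x \<in> X; y \<in> X\<rbrakk> \<Longrightarrow> e x y = 0 \<longleftrightarrow> x = y"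
    and triangle: "\<And>x y z. \<lbrakk>x \<in> X; y \<in> X; z \<in> X\<rbrakk> \<Longrightarrow> e x z \<le> e x y + e y z"

definition qball :: "'a set \<Rightarrow> ('a \<Rightarrow> 'a \<Rightarrow> real) \<Rightarrow> 'a \<Rightarrow> real \<Rightarrow> 'a set" where
  "qball X e p t = {x \<in> X. e x p < t \<and> e p x < t}"

definition qtopology :: "'a set \<Rightarrow> ('a \<Rightarrow> 'a \<Rightarrow> real) \<Rightarrow> 'a topology" where
  "qtopology X e = topology_generated_by {qball X e p t |p t. p \<in> X \<and> 0 < t}"

definition sym_metric :: "('a \<Rightarrow> 'a \<Rightarrow> real) \<Rightarrow> 'a \<Rightarrow> 'a \<Rightarrow> real" where
  "sym_metric e x y = max (e x y) (e y x)"

lemma topspace_qtopology: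
  assumes "Quasi_metric_space X e"
  shows "topspace (qtopology X e) = X"
proof -
  interpret Quasi_metric_space X e by fact
  have "x \<in> \<Union>{qball X e p t |p t. p \<in> X \<and> 0 < t}" if "x \<in> X" for x
  proof (rule UnionI)
    show "qball X e x 1 \<in> {qball X e p t |p t. p \<in> X \<and> 0 < t}"
      using that zero_less_one by blast
    show "x \<in> qball X e x 1"
      using that zero[of x x] by (simp add: qball_def)
  qed
  moreover have "\<Union>{qball X e p t |p t. p \<in> X \<and> 0 < t} \<subseteq> X"
    by (auto simp: qball_def)
  ultimately have "\<Union>{qball X e p t |p t. p \<in> X \<and> 0 < t} = X"
    by blast
  then show ?thesis
    by (simp add: qtopology_def)
qed

lemma Metric_space_sym_metric:
  assumes "Quasi_metric_space X e"
  shows "Metric_space X (sym_metric e)"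
proof -
  interpret Quasi_metric_space X e by fact
  show ?thesis
  proof
    show "0 \<le> sym_metric e x y" for x y
      using nonneg[of x y] by (simp add: sym_metric_def)
    show "sym_metric e x y = sym_metric e y x" for x y
      by (simp add: sym_metric_def max.commute)
    show "sym_metric e x y = 0 \<longleftrightarrow> x = y" if "x \<in> X" "y \<in> X" for x y
      using nonneg[of x y] nonneg[of y x] zero[of x y] zero[of y x] that
      by (auto simp: sym_metric_def max_def)
    show "sym_metric e x z \<le> sym_metric e x y + sym_metric e y z"
      if "x \<in> X" "y \<in> X" "z \<in> X" for x y z
      using triangle[of x y z] triangle[of z y x] that
      by (auto simp: sym_metric_def max_def)
  qed
qed

text \<open>Used for both \<open>d\<^sub>n\<close> and \<open>e\<^sub>n\<close>; meaningful only for \<open>n \<ge> 1\<close>.  The value at \<open>n = 0\<close>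
  does not affect the entropies below, which are defined through a limit superior in \<open>n\<close>.\<close>

definition orbit_dist :: "('a \<Rightarrow> 'a) \<Rightarrow> ('a \<Rightarrow> 'a \<Rightarrow> real) \<Rightarrow> nat \<Rightarrow> 'a \<Rightarrow> 'a \<Rightarrow> real" where
  "orbit_dist T d n x y = Max ((\<lambda>i. d ((T ^^ i) x) ((T ^^ i) y)) ` {0..<n})"

definition spanning :: "'a set \<Rightarrow> ('a \<Rightarrow> 'a \<Rightarrow> real) \<Rightarrow> ('a \<Rightarrow> 'a) \<Rightarrow> nat \<Rightarrow> real \<Rightarrow> 'a set \<Rightarrow> 'a set \<Rightarrow> bool" where
  "spanning X d T n \<epsilon> K F \<longleftrightarrow>
     F \<subseteq> X \<and> (\<forall>x\<in>K. \<exists>y\<in>F. orbit_dist T d n x y \<le> \<epsilon>)"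

definition qspanning :: "'a set \<Rightarrow> ('a \<Rightarrow> 'a \<Rightarrow> real) \<Rightarrow> ('a \<Rightarrow> 'a) \<Rightarrow> nat \<Rightarrow> real \<Rightarrow> 'a set \<Rightarrow> 'a set \<Rightarrow> bool" where
  "qspanning X e T n \<epsilon> K F \<longleftrightarrow>
     F \<subseteq> X \<and> (\<forall>x\<in>K. \<exists>y\<in>F. orbit_dist T e n x y \<le> \<epsilon> \<and> orbit_dist T e n y x \<le> \<epsilon>)"

text \<open>The minimum is taken over finite spanning sets, since \<^const>\<open>card\<close> is \<open>0\<close> on infinite sets.
  For \<open>K\<close> compact, \<open>T\<close> continuous, \<open>n \<ge> 1\<close> and \<open>\<epsilon> > 0\<close> a finite spanning set always exists.\<close>

definition span_card :: "'a set \<Rightarrow> ('a \<Rightarrow> 'a \<Rightarrow> real) \<Rightarrow> ('a \<Rightarrow> 'a) \<Rightarrow> nat \<Rightarrow> real \<Rightarrow> 'a set \<Rightarrow> nat" where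
  "span_card X d T n \<epsilon> K = (LEAST k. \<exists>F. finite F \<and> card F = k \<and> spanning X d T n \<epsilon> K F)"

definition qspan_card :: "'a set \<Rightarrow> ('a \<Rightarrow> 'a \<Rightarrow> real) \<Rightarrow> ('a \<Rightarrow> 'a) \<Rightarrow> nat \<Rightarrow> real \<Rightarrow> 'a set \<Rightarrow> nat" where
  "qspan_card X e T n \<epsilon> K = (LEAST k. \<exists>F. finite F \<and> card F = k \<and> qspanning X e T n \<epsilon> K F)"

definition log_ereal :: "nat \<Rightarrow> ereal" where
  "log_ereal k = (if k = 0 then - \<infinity> else ereal (ln (real k)))"

text \<open>The limit as \<open>\<epsilon>\<close> decreases to \<open>0\<close> exists because the spanning cardinalities are antitone
  in \<open>\<epsilon>\<close>.\<close>

definition metric_entropy :: "'a set \<Rightarrow> ('a \<Rightarrow> 'a \<Rightarrow> real) \<Rightarrow> ('a \<Rightarrow> 'a) \<Rightarrow> ereal" where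
  "metric_entropy X d T =
     (SUP K \<in> {K. compactin (Metric_space.mtopology X d) K}.
        Lim (at_right 0) (\<lambda>\<epsilon>. limsup (\<lambda>n. log_ereal (span_card X d T n \<epsilon> K) / ereal (real n))))"

definition quasi_metric_entropy :: "'a set \<Rightarrow> ('a \<Rightarrow> 'a \<Rightarrow> real) \<Rightarrow> ('a \<Rightarrow> 'a) \<Rightarrow> ereal" where
  "quasi_metric_entropy X e T =
     (SUP K \<in> {K. compactin (qtopology X e) K}.
        Lim (at_right 0) (\<lambda>\<epsilon>. limsup (\<lambda>n. log_ereal (qspan_card X e T n \<epsilon> K) / ereal (real n))))"

end

theory Submission
  imports Defs
begin

text \<open>Closeness for a quasi-metric is always demanded in both directions, and asking that
  \<open>e x y\<close> and \<open>e y x\<close> both lie below a bound is asking that their maximum does.  On the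
  topological side this makes the two-sided balls of \<open>e\<close> the balls of the symmetrised metric, so
  both suprema run over the same compact sets.  On the dynamical side the maximum along an
  orbit segment commutes with the maximum over the two directions, so both notions of
  spanning set, hence both minimal cardinalities, agree for every length, scale and compact set.\<close>

lemma (in Metric_space) mtopology_generated_by_mballs:
  "mtopology = topology_generated_by {mball p t |p t. p \<in> M \<and> 0 < t}"
    (is "_ = topology_generated_by ?B")
proof (rule topology_eq[THEN iffD2], intro allI iffI)
  fix U
  assume U: "openin mtopology U"
  \<comment> \<open>An open set is the union of the balls that it contains.\<close>
  have "U = \<Union>{b \<in> ?B. b \<subseteq> U}"
  proof (intro equalityI subsetI)
    fix x
    assume "x \<in> U"
    then obtain r where "x \<in> M" "0 < r" "mball x r \<subseteq> U"
      using U unfolding openin_mtopology by blast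
    then have "mball x r \<in> {b \<in> ?B. b \<subseteq> U}" "x \<in> mball x r"
      by auto
    then show "x \<in> \<Union>{b \<in> ?B. b \<subseteq> U}"
      by (rule UnionI)
  qed blast
  moreover have "openin (topology_generated_by ?B) (\<Union>{b \<in> ?B. b \<subseteq> U})"
    by (rule openin_Union) (blast intro: topology_generated_by_Basis)
  ultimately show "openin (topology_generated_by ?B) U"
    by simp
next
  fix U
  assume "openin (topology_generated_by ?B) U"
  then have "generate_topology_on ?B U"
    by (rule openin_topology_generated_by)
  then show "openin mtopology U"
    by induction (auto intro: openin_mball)
qed

lemma mtopology_sym_metric:
  assumes "Quasi_metric_space X e"
  shows "Metric_space.mtopology X (sym_metric e) = qtopology X e"
proof -
  interpret S: Metric_space X "sym_metric e"
    using assms by (rule Metric_space_sym_metric)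
  have "qball X e p t = S.mball p t" if "p \<in> X" for p t
    using that by (auto simp: qball_def S.mball_def sym_metric_def)
  then have "{qball X e p t |p t. p \<in> X \<and> 0 < t} = {S.mball p t |p t. p \<in> X \<and> 0 < t}"
    by blast
  then show ?thesis
    by (simp add: S.mtopology_generated_by_mballs qtopology_def)
qed

lemma orbit_dist_sym_metric:
  "orbit_dist T (sym_metric e) n x y = max (orbit_dist T e n x y) (orbit_dist T e n y x)"
proof (cases "n = 0")
  case True
  \<comment> \<open>The maximum of the empty set is one and the same unspecified number in all three terms.\<close>
  then show ?thesis
    by (simp add: orbit_dist_def)
next
  case False
  \<comment> \<open>Both sides have the same upper bounds.\<close>
  then have "orbit_dist T (sym_metric e) n x y \<le> c \<longleftrightarrow>
      max (orbit_dist T e n x y) (orbit_dist T e n y x) \<le> c" for c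
    by (auto simp: orbit_dist_def sym_metric_def)
  then show ?thesis
    by (meson order.antisym order.refl)
qed

lemma spanning_sym_metric_iff:
  "spanning X (sym_metric e) T n \<epsilon> K F \<longleftrightarrow> qspanning X e T n \<epsilon> K F"
  by (simp add: spanning_def qspanning_def orbit_dist_sym_metric)

lemma span_card_sym_metric:
  "span_card X (sym_metric e) T n \<epsilon> K = qspan_card X e T n \<epsilon> K"
  by (simp add: span_card_def qspan_card_def spanning_sym_metric_iff)

theorem theorem3p2:
  fixes X :: "'a set" and e :: "'a \<Rightarrow> 'a \<Rightarrow> real" and T :: "'a \<Rightarrow> 'a"
  assumes "Quasi_metric_space X e"
    and "continuous_map (qtopology X e) (qtopology X e) T"
  shows "metric_entropy X (sym_metric e) T = quasi_metric_entropy X e T"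
  using assms(1)
  by (simp add: metric_entropy_def quasi_metric_entropy_def mtopology_sym_metric
      span_card_sym_metric)

end
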